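(* Let $n\in\mathbb{N}$ and $s\in\mathbb{C}\setminus\{-1,-2,-3,\dots\}$. Then \begin{align*} &\sum_{k=1}^{n}\frac{(-1)^{k-1}}{k}\binom{s+n}{k}\Big\{(\psi(s+n+1)-\psi(s+n-k+1))^2+\psi'(s+n+1)-\psi'(s+n-k+1)\Big\}\\ &=2\sum_{k=0}^{n-1}\frac{(-1)^k\binom{s+k}{k}}{(k+1)^2\binom{n}{k+1}}[\psi(s+k+1)-\psi(s+1)]\\ &\quad+s\sum_{k=0}^{n-1}\frac{(-1)^k\binom{s+k}{k}}{(k+1)^2\binom{n}{k+1}}\Big\{(\psi(s+k+1)-\psi(s+1))^2+\psi'(s+k+1)-\psi'(s+1)\Big\}. \end{align*}
   Context: $\psi=\Gamma'/\Gamma$ is the digamma function and $\psi'$ its derivative. For $z\in\mathbb{C}$ and $k\in\mathbb{N}_0$, $\binom{z}{k}=\frac{z(z-1)\cdots(z-k+1)}{k!}$. *)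

theory Defs
  imports "HOL-Analysis.Analysis"
begin

text \<open>
  The library defines \<^term>\<open>Digamma\<close> by its series; away from the poles of the Gamma function
  it is the logarithmic derivative of the Gamma function.
\<close>

lemma Digamma_eq_logderiv_Gamma:
  fixes z :: complex
  assumes "z \<notin> \<int>\<^sub>\<le>\<^sub>0"
  shows "Digamma z = deriv Gamma z / Gamma z"
proof -
  have "deriv Gamma z = Gamma z * Digamma z"
    by (rule DERIV_imp_deriv, rule has_field_derivative_Gamma[OF assms])
  moreover have "Gamma z \<noteq> 0"
    using assms by (simp add: Gamma_eq_zero_iff)
  ultimately show ?thesis by simp
qed

end

theory Submission
  imports Defs "HOL-Computational_Algebra.Polynomial"
begin

text \<open>
  Differentiating the generalized binomial coefficient \<open>z gchoose k\<close> twice in \<open>z\<close> produces exactly the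
  digamma expressions of the theorem. With
  \<open>F(s) = \<Sum>k=1..n. (-1)^(k-1) / k * ((s+n) gchoose k)\<close> and
  \<open>G(s) = \<Sum>k<n. (-1)^k * ((s+k) gchoose k) / ((k+1)^2 * (n choose (k+1)))\<close> the claim is therefore
  \<open>F'' = 2 G' + s G'' = (s G)''\<close>, so it suffices that \<open>F(s) - s G(s)\<close> is constant. It is a
  polynomial in \<open>s\<close>, and its forward difference vanishes at every natural number.
\<close>

section \<open>Derivatives of the generalized binomial coefficient\<close>

text \<open>On this set \<open>z gchoose k\<close> is a quotient of Gamma values; openness lets a
  derivative computed for the quotient be transferred to the binomial coefficient.\<close>

lemma open_shifted_nonpos_Ints_compl:
  "open {z::complex. z - of_nat k + 1 \<notin> \<int>\<^sub>\<le>\<^sub>0}"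
proof -
  have "open ((\<lambda>z::complex. z - of_nat k + 1) -` (- \<int>\<^sub>\<le>\<^sub>0))"
    by (intro open_vimage continuous_intros open_Compl closed_nonpos_Ints)
  then show ?thesis
    by (simp add: vimage_def)
qed

lemma plus_of_nat_not_in_nonpos_Ints:
  fixes w :: complex
  assumes "w \<notin> \<int>\<^sub>\<le>\<^sub>0"
  shows "w + of_nat k \<notin> \<int>\<^sub>\<le>\<^sub>0"
  using assms nonpos_Ints_diff_Nats[of "w + of_nat k" "of_nat k"] by auto

lemma shifted_not_in_nonpos_Ints:
  fixes z :: complex
  assumes "z - of_nat k + 1 \<notin> \<int>\<^sub>\<le>\<^sub>0"
  shows "z + 1 \<notin> \<int>\<^sub>\<le>\<^sub>0"
  using plus_of_nat_not_in_nonpos_Ints[OF assms, of k] by (simp add: algebra_simps)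

text \<open>Logarithmic differentiation of
  \<open>Gamma (z + 1) / (fact k * Gamma (z - of_nat k + 1))\<close>: each Gamma factor contributes
  one digamma value. The hypothesis keeps both arguments away from the poles of Gamma.\<close>

lemma has_field_derivative_gbinomial:
  fixes z :: complex
  assumes z: "z - of_nat k + 1 \<notin> \<int>\<^sub>\<le>\<^sub>0"
  shows "((\<lambda>z. z gchoose k) has_field_derivative
           (z gchoose k) * (Digamma (z + 1) - Digamma (z - of_nat k + 1))) (at z)"
proof (rule has_field_derivative_transform_within_open)
  note z1 = shifted_not_in_nonpos_Ints[OF z]
  have [simp]: "Gamma (z - of_nat k + 1) \<noteq> 0"
    using z by (simp add: Gamma_eq_zero_iff)
  have eq: "z gchoose k = Gamma (z + 1) / (fact k * Gamma (z - of_nat k + 1))"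
    by (rule gbinomial_Gamma[OF z1])
  show "((\<lambda>z. Gamma (z + 1) / (fact k * Gamma (z - of_nat k + 1))) has_field_derivative
           (z gchoose k) * (Digamma (z + 1) - Digamma (z - of_nat k + 1))) (at z)"
  proof -
    have "((\<lambda>z. Gamma (z + 1)) has_field_derivative Gamma (z + 1) * Digamma (z + 1)) (at z)"
      using DERIV_shift[of Gamma _ z 1] has_field_derivative_Gamma[OF z1, of UNIV] by simp
    moreover have "((\<lambda>z. fact k * Gamma (z - of_nat k + 1)) has_field_derivative
        fact k * (Gamma (z - of_nat k + 1) * Digamma (z - of_nat k + 1))) (at z)"
      using DERIV_shift[of Gamma _ z "1 - of_nat k"] has_field_derivative_Gamma[OF z, of UNIV]
      by (intro DERIV_cmult) (simp add: algebra_simps)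
    ultimately show ?thesis
      unfolding eq
      by (rule DERIV_cong[OF DERIV_divide]) (simp_all add: divide_simps right_diff_distrib mult_ac)
  qed
  show "Gamma (w + 1) / (fact k * Gamma (w - of_nat k + 1)) = w gchoose k"
    if "w \<in> {z. z - of_nat k + 1 \<notin> \<int>\<^sub>\<le>\<^sub>0}" for w :: complex
    using gbinomial_Gamma[OF shifted_not_in_nonpos_Ints[of w k]] that by simp
qed (use z open_shifted_nonpos_Ints_compl in auto)

lemma has_field_derivative_Digamma:
  fixes z :: complex
  assumes "z \<notin> \<int>\<^sub>\<le>\<^sub>0"
  shows "(Digamma has_field_derivative deriv Digamma z) (at z)"
  using has_field_derivative_Polygamma[OF assms, of 0] DERIV_imp_deriv by metis

text \<open>If D is the difference of the digamma values and B the binomial coefficient, then B' = B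
  D, so the product rule gives (B D)' = B (D^2 + D').\<close>

lemma has_field_derivative_gbinomial_Digamma:
  fixes z :: complex
  assumes z: "z - of_nat k + 1 \<notin> \<int>\<^sub>\<le>\<^sub>0"
  shows "((\<lambda>z. (z gchoose k) * (Digamma (z + 1) - Digamma (z - of_nat k + 1)))
           has_field_derivative
           (z gchoose k) * ((Digamma (z + 1) - Digamma (z - of_nat k + 1))\<^sup>2
              + deriv Digamma (z + 1) - deriv Digamma (z - of_nat k + 1))) (at z)"
proof -
  have "((\<lambda>z. Digamma (z + 1)) has_field_derivative deriv Digamma (z + 1)) (at z)"
    using DERIV_shift[of Digamma _ z 1]
      has_field_derivative_Digamma[OF shifted_not_in_nonpos_Ints[OF z]] by simp
  moreover have "((\<lambda>z. Digamma (z - of_nat k + 1)) has_field_derivative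
      deriv Digamma (z - of_nat k + 1)) (at z)"
    using DERIV_shift[of Digamma _ z "1 - of_nat k"]
      has_field_derivative_Digamma[OF z] by (simp add: algebra_simps)
  ultimately show ?thesis
    by (rule DERIV_cong[OF DERIV_mult[OF has_field_derivative_gbinomial[OF z] DERIV_diff]])
      (simp add: algebra_simps power2_eq_square)
qed

section \<open>The underlying polynomial identity\<close>

lemma gbinomial_eq_poly: "\<exists>p. \<forall>x::complex. (x + a) gchoose k = poly p x"
proof -
  \<comment> \<open>The falling factorial of \<open>x + a\<close>, split into the linear factors
    \<open>x + (a - i)\<close>.\<close>
  let ?p = "smult (1 / fact k) (\<Prod>i = 0..<k. [:a - of_nat i, 1:])"
  have "(x + a) gchoose k = poly ?p x" for x
    by (simp add: gbinomial_prod_rev poly_prod algebra_simps)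
  then show ?thesis by blast
qed

lemma sum_eq_poly:
  fixes f :: "'b \<Rightarrow> complex \<Rightarrow> complex"
  assumes "\<And>i. i \<in> A \<Longrightarrow> \<exists>p. \<forall>x. f i x = poly p x"
  shows "\<exists>p. \<forall>x. (\<Sum>i\<in>A. c i * f i x) = poly p x"
proof -
  obtain p where "\<And>i x. i \<in> A \<Longrightarrow> f i x = poly (p i) x"
    using assms by metis
  then have "(\<Sum>i\<in>A. c i * f i x) = poly (\<Sum>i\<in>A. smult (c i) (p i)) x" for x
    by (simp add: poly_sum)
  then show ?thesis by blast
qed

text \<open>The polynomial \<open>p - [:c:]\<close> has infinitely many roots, hence is zero. This
  carries an identity proved by induction on the naturals over to complex arguments.\<close>

lemma poly_eq_const_if_const_on_nats:
  fixes p :: "complex poly"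
  assumes "\<And>m::nat. poly p (of_nat m) = c"
  shows "poly p x = c"
proof -
  have "infinite (range (of_nat :: nat \<Rightarrow> complex))"
    by (simp add: infinite_UNIV_char_0 inj_on_def finite_image_iff)
  moreover have "range of_nat \<subseteq> {x. poly (p - [:c:]) x = 0}"
    using assms by auto
  ultimately have "p - [:c:] = 0"
    using poly_roots_finite finite_subset by blast
  then show ?thesis by simp
qed

section \<open>Forward differences of the two sums\<close>

text \<open>The sum telescopes: consecutive summands have the ratio -(s + p + 1) / (N - p), so s + N
  + 2 times a summand is a difference of consecutive values of (s + p + 1) times the
  summand.\<close>

lemma gbinomial_ratio_partial_sum:
  fixes s :: complex
  assumes "p \<le> N"
  shows "(s + of_nat N + 2) * (\<Sum>i\<le>p. (-1) ^ i * ((s + of_nat i) gchoose i) / of_nat (N choose i))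
    = of_nat N + 1
      + (s + of_nat p + 1) * ((-1) ^ p * ((s + of_nat p) gchoose p) / of_nat (N choose p))"
  using assms
proof (induction p)
  case 0
  then show ?case by simp
next
  case (Suc p)
  define u where "u i = (-1) ^ i * ((s + of_nat i) gchoose i) / of_nat (N choose i)" for i
  have A: "of_nat (Suc p) * ((s + of_nat (Suc p)) gchoose Suc p)
      = (s + of_nat (Suc p)) * ((s + of_nat p) gchoose p)"
    using gbinomial_absorption[of p "s + of_nat (Suc p)"] by (simp add: algebra_simps)
  have B: "of_nat (Suc p) * of_nat (N choose Suc p) = (of_nat N - of_nat p) * (of_nat (N choose p) :: complex)"
  proof -
    have "Suc p * (N choose Suc p) = (N - p) * (N choose p)"
      using binomial_absorb_comp[of N p] binomial_absorption[of p N] by simp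
    then have "(of_nat (Suc p * (N choose Suc p)) :: complex) = of_nat ((N - p) * (N choose p))"
      by simp
    with Suc.prems show ?thesis by (simp only: of_nat_mult of_nat_diff)
  qed
  have nz: "(of_nat (N choose Suc p) :: complex) \<noteq> 0" "(of_nat (N choose p) :: complex) \<noteq> 0"
    using Suc.prems by auto
  have step: "(of_nat N - of_nat p) * u (Suc p) = - (s + of_nat p + 1) * u p"
  proof -
    \<comment> \<open>All denominators are cleared first, so that \<open>A\<close> and
      \<open>B\<close> can be substituted; the extra factors are nonzero and cancel at the
      end.\<close>
    have "of_nat (Suc p) * ((of_nat N - of_nat p) * u (Suc p)) * of_nat (N choose p) * of_nat (N choose Suc p)
       = - ((-1) ^ p) * (of_nat (Suc p) * ((s + of_nat (Suc p)) gchoose Suc p)) * ((of_nat N - of_nat p) * of_nat (N choose p))"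
      using nz by (simp add: u_def)
    also have "\<dots> = - ((-1) ^ p) * ((s + of_nat (Suc p)) * ((s + of_nat p) gchoose p))
        * (of_nat (Suc p) * of_nat (N choose Suc p))"
      by (simp only: A B)
    also have "\<dots> = of_nat (Suc p) * (- (s + of_nat p + 1)) * ((-1) ^ p * ((s + of_nat p) gchoose p))
        * of_nat (N choose Suc p)"
      by (simp add: algebra_simps)
    also have "(-1) ^ p * ((s + of_nat p) gchoose p) = u p * of_nat (N choose p)"
      using nz by (simp add: u_def)
    also have "of_nat (Suc p) * (- (s + of_nat p + 1)) * (u p * of_nat (N choose p)) * of_nat (N choose Suc p)
        = of_nat (Suc p) * (- (s + of_nat p + 1) * u p) * of_nat (N choose p) * of_nat (N choose Suc p)"
      by (simp only: mult_ac)
    finally show ?thesis using nz by (simp del: of_nat_Suc)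
  qed
  have "(s + of_nat N + 2) * (\<Sum>i\<le>p. u i) = of_nat N + 1 + (s + of_nat p + 1) * u p"
    using Suc by (simp add: u_def)
  \<comment> \<open>For the new summand, split s + N + 2 = (s + p + 2) + (N - p); by
    \<open>step\<close> the second part cancels the old boundary term.\<close>
  then have "(s + of_nat N + 2) * (\<Sum>i\<le>Suc p. u i)
      = of_nat N + 1 + (s + of_nat (Suc p) + 1) * u (Suc p)"
    using step by (simp add: algebra_simps)
  then show ?case by (simp only: u_def)
qed

text \<open>Pascal's rule reduces each difference to \<open>z gchoose (k - 1)\<close>. The factor
  \<open>z + 1\<close> is absorbed into it, which cancels 1/k and leaves an alternating sum of
  binomial coefficients with a closed form.\<close>

lemma gbinomial_harmonic_sum_diff:
  fixes z :: complex
  shows "(z + 1) * ((\<Sum>k=1..n. (-1) ^ (k - 1) / of_nat k * ((z + 1) gchoose k))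
      - (\<Sum>k=1..n. (-1) ^ (k - 1) / of_nat k * (z gchoose k)))
    = 1 - (-1) ^ n * (z gchoose n)"
proof -
  have summand: "(z + 1) * ((-1) ^ (k - 1) / of_nat k * (((z + 1) gchoose k) - (z gchoose k)))
      = - ((-1) ^ k * ((z + 1) gchoose k))" if k: "k \<in> {1..n}" for k
  proof -
    obtain j where j: "k = Suc j" using k by (cases k) auto
    have "((z + 1) gchoose Suc j) - (z gchoose Suc j) = z gchoose j"
      by (simp add: gbinomial_Suc_Suc)
    then have "(z + 1) * ((-1) ^ (k - 1) / of_nat k * (((z + 1) gchoose k) - (z gchoose k)))
        = (-1) ^ j / of_nat (Suc j) * ((z + 1) * (z gchoose j))"
      by (simp only: j diff_Suc_1 mult.left_commute)
    also have "(z + 1) * (z gchoose j) = of_nat (Suc j) * ((z + 1) gchoose Suc j)"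
      using gbinomial_absorption[of j "z + 1"] by simp
    finally show ?thesis
      by (simp add: j del: of_nat_Suc)
  qed
  have "(z + 1) * ((\<Sum>k=1..n. (-1) ^ (k - 1) / of_nat k * ((z + 1) gchoose k))
      - (\<Sum>k=1..n. (-1) ^ (k - 1) / of_nat k * (z gchoose k)))
      = (\<Sum>k=1..n. (z + 1) * ((-1) ^ (k - 1) / of_nat k * (((z + 1) gchoose k) - (z gchoose k))))"
    by (simp add: sum_subtractf sum_distrib_left right_diff_distrib)
  also have "\<dots> = (\<Sum>k=1..n. - ((-1) ^ k * ((z + 1) gchoose k)))"
    by (rule sum.cong[OF refl summand])
  \<comment> \<open>The full alternating sum also contains the term for \<open>k = 0\<close>, which
    is 1.\<close>
  also have "\<dots> = 1 - (\<Sum>k\<le>n. (-1) ^ k * ((z + 1) gchoose k))"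
    by (simp add: sum_negf atMost_atLeast0 sum.atLeast_Suc_atMost)
  also have "(\<Sum>k\<le>n. (-1) ^ k * ((z + 1) gchoose k)) = (-1) ^ n * (z gchoose n)"
    using gbinomial_sum_lower_neg[of "z + 1" n] by (simp add: mult.commute)
  finally show ?thesis .
qed

text \<open>Absorption and Pascal's rule turn the difference of
  \<open>s * ((s + of_nat k) gchoose k)\<close> into k + 1 times the binomial coefficient. Together
  with (k + 1) C(n, k + 1) = n C(n - 1, k) this removes the square from the denominator, and the
  telescoping sum above remains. The right-hand side is that of
  \<open>gbinomial_harmonic_sum_diff\<close> at z = s + n.\<close>

lemma gbinomial_reciprocal_sum_diff:
  fixes s :: complex
  assumes "n \<ge> 1"
  defines "G \<equiv> \<lambda>s::complex. \<Sum>k=0..<n. (-1) ^ k * ((s + of_nat k) gchoose k)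
              / ((of_nat (k + 1))\<^sup>2 * of_nat (n choose (k + 1)))"
  shows "(s + of_nat n + 1) * ((s + 1) * G (s + 1) - s * G s)
    = 1 - (-1) ^ n * ((s + of_nat n) gchoose n)"
proof -
  obtain N where N: "n = Suc N" using assms by (cases n) auto
  have rising: "s * ((s + of_nat k) gchoose k) = of_nat (Suc k) * ((s + of_nat k) gchoose Suc k)"
    for s :: complex and k
    using gbinomial_absorb_comp[of "s + of_nat k" k] gbinomial_absorption[of k "s + of_nat k"]
    by simp
  have summand: "(s + 1) * ((-1) ^ k * ((s + 1 + of_nat k) gchoose k)
              / ((of_nat (k + 1))\<^sup>2 * of_nat (n choose (k + 1))))
      - s * ((-1) ^ k * ((s + of_nat k) gchoose k)
              / ((of_nat (k + 1))\<^sup>2 * of_nat (n choose (k + 1))))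
      = ((-1) ^ k * ((s + of_nat k) gchoose k) / of_nat (N choose k)) / of_nat n"
    if "k \<in> {0..<n}" for k
  proof -
    have d: "(s + 1) * ((s + 1 + of_nat k) gchoose k) - s * ((s + of_nat k) gchoose k)
        = of_nat (Suc k) * ((s + of_nat k) gchoose k)"
      unfolding rising using gbinomial_Suc_Suc[of "s + of_nat k" k]
      by (simp add: algebra_simps)
    have "(of_nat (Suc k * (n choose Suc k)) :: complex) = of_nat (n * (N choose k))"
      using binomial_absorption[of k n] by (simp only: N diff_Suc_1)
    then have e: "(of_nat (k + 1))\<^sup>2 * of_nat (n choose (k + 1))
        = of_nat (Suc k) * (of_nat n * (of_nat (N choose k) :: complex))"
      by (simp only: Suc_eq_plus1 power2_eq_square mult.assoc of_nat_mult)
    have "(s + 1) * ((-1) ^ k * ((s + 1 + of_nat k) gchoose k)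
              / ((of_nat (k + 1))\<^sup>2 * of_nat (n choose (k + 1))))
      - s * ((-1) ^ k * ((s + of_nat k) gchoose k)
              / ((of_nat (k + 1))\<^sup>2 * of_nat (n choose (k + 1))))
      = (-1) ^ k * ((s + 1) * ((s + 1 + of_nat k) gchoose k) - s * ((s + of_nat k) gchoose k))
              / ((of_nat (k + 1))\<^sup>2 * of_nat (n choose (k + 1)))"
      by (simp add: diff_divide_distrib right_diff_distrib mult_ac)
    also have "\<dots> = ((-1) ^ k * ((s + of_nat k) gchoose k) / of_nat (N choose k)) / of_nat n"
      unfolding d e by (simp del: of_nat_Suc)
    finally show ?thesis .
  qed
  have "(s + 1) * G (s + 1) - s * G s
      = (\<Sum>k=0..<n. ((-1) ^ k * ((s + of_nat k) gchoose k) / of_nat (N choose k)) / of_nat n)"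
    unfolding G_def sum_distrib_left sum_subtractf[symmetric] by (rule sum.cong[OF refl summand])
  also have "\<dots> = (\<Sum>k\<le>N. (-1) ^ k * ((s + of_nat k) gchoose k) / of_nat (N choose k)) / of_nat n"
    by (simp add: N sum_divide_distrib atLeast0LessThan lessThan_Suc_atMost)
  finally have "((s + 1) * G (s + 1) - s * G s) * of_nat n
      = (\<Sum>k\<le>N. (-1) ^ k * ((s + of_nat k) gchoose k) / of_nat (N choose k))"
    using assms(1) by simp
  moreover have "s + of_nat n + 1 = s + of_nat N + 2"
    by (simp add: N)
  ultimately have "(s + of_nat n + 1) * ((s + 1) * G (s + 1) - s * G s) * of_nat n
      = (s + of_nat N + 2) * (\<Sum>k\<le>N. (-1) ^ k * ((s + of_nat k) gchoose k) / of_nat (N choose k))"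
    by (simp only: mult.assoc)
  \<comment> \<open>The telescoped sum is taken up to its last index \<open>p = N\<close>, where
    \<open>N choose N\<close> is 1.\<close>
  also have "\<dots> = of_nat n + (-1) ^ N * ((s + of_nat n) * ((s + of_nat N) gchoose N))"
    unfolding gbinomial_ratio_partial_sum[OF order_refl] by (simp add: N algebra_simps)
  also have "(s + of_nat n) * ((s + of_nat N) gchoose N) = of_nat n * ((s + of_nat n) gchoose n)"
    using gbinomial_absorption[of N "s + of_nat n"] by (simp add: N algebra_simps)
  finally have "of_nat n * ((s + of_nat n + 1) * ((s + 1) * G (s + 1) - s * G s))
      = of_nat n * (1 - (-1) ^ n * ((s + of_nat n) gchoose n))"
    by (simp add: N algebra_simps del: of_nat_Suc)
  then show ?thesis using assms(1) by simp
qed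

text \<open>The two preceding lemmas give the left sum and s times the right sum the same forward
  difference. Hence they differ by a constant, found by putting s = 0.\<close>

lemma gbinomial_harmonic_sum_eq:
  fixes s :: complex
  assumes "n \<ge> 1"
  shows "(\<Sum>k=1..n. (-1) ^ (k - 1) / of_nat k * ((s + of_nat n) gchoose k))
    = (\<Sum>k=1..n. (-1) ^ (k - 1) / of_nat k * (of_nat n gchoose k))
      + s * (\<Sum>k=0..<n. (-1) ^ k * ((s + of_nat k) gchoose k)
              / ((of_nat (k + 1))\<^sup>2 * of_nat (n choose (k + 1))))"
proof -
  define F where "F = (\<lambda>s::complex. \<Sum>k=1..n. (-1) ^ (k - 1) / of_nat k * ((s + of_nat n) gchoose k))"
  define G where "G = (\<lambda>s::complex. \<Sum>k=0..<n. (-1) ^ k * ((s + of_nat k) gchoose k)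
              / ((of_nat (k + 1))\<^sup>2 * of_nat (n choose (k + 1))))"
  have "\<exists>p. \<forall>x. F x = poly p x"
    unfolding F_def by (rule sum_eq_poly[OF gbinomial_eq_poly])
  then obtain p where p: "\<And>x. F x = poly p x"
    by blast
  have "\<exists>q. \<forall>x::complex. (\<Sum>k=0..<n. ((-1) ^ k / ((of_nat (k + 1))\<^sup>2 * of_nat (n choose (k + 1))))
      * ((x + of_nat k) gchoose k)) = poly q x"
    by (rule sum_eq_poly) (rule gbinomial_eq_poly)
  then obtain q where q: "\<And>x. G x = poly q x"
    unfolding G_def by auto
  \<comment> \<open>The known differences carry the factor s + n + 1. At natural s it is nonzero and
    can be cancelled, so the induction runs over the naturals only.\<close>
  have "F (of_nat m) - of_nat m * G (of_nat m) = F 0" for m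
  proof (induction m)
    case 0
    show ?case by simp
  next
    case (Suc m)
    let ?s = "of_nat m :: complex"
    have "(?s + of_nat n + 1) * (F (?s + 1) - F ?s) = (?s + of_nat n + 1) * ((?s + 1) * G (?s + 1) - ?s * G ?s)"
      using gbinomial_harmonic_sum_diff[of "?s + of_nat n" n]
        gbinomial_reciprocal_sum_diff[OF assms, of ?s]
      unfolding F_def G_def by (simp add: add_ac)
    moreover have "?s + of_nat n + 1 \<noteq> 0"
      by (metis of_nat_Suc of_nat_add of_nat_neq_0 add.commute)
    ultimately have "F (?s + 1) - F ?s = (?s + 1) * G (?s + 1) - ?s * G ?s"
      by simp
    with Suc show ?case by (simp add: algebra_simps)
  qed
  then have "poly (p - [:0, 1:] * q) (of_nat m) = F 0" for m
    by (simp add: p q)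
  then have "poly (p - [:0, 1:] * q) s = F 0"
    by (rule poly_eq_const_if_const_on_nats)
  then have "F s = F 0 + s * G s"
    by (simp add: p q algebra_simps)
  then show ?thesis by (simp add: F_def G_def)
qed

section \<open>Differentiating the polynomial identity twice\<close>

theorem theorem2p8:
  fixes n :: nat and s :: complex
  assumes "n \<ge> 1"
    and "\<forall>m::nat. m \<ge> 1 \<longrightarrow> s \<noteq> - of_nat m"
  shows
    "(\<Sum>k=1..n. (-1) ^ (k - 1) / of_nat k * ((s + of_nat n) gchoose k) *
        ((Digamma (s + of_nat n + 1) - Digamma (s + of_nat n - of_nat k + 1))\<^sup>2
          + deriv Digamma (s + of_nat n + 1) - deriv Digamma (s + of_nat n - of_nat k + 1)))
     = 2 * (\<Sum>k=0..<n. (-1) ^ k * ((s + of_nat k) gchoose k)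
              / ((of_nat (k + 1))\<^sup>2 * of_nat (n choose (k + 1)))
              * (Digamma (s + of_nat k + 1) - Digamma (s + 1)))
       + s * (\<Sum>k=0..<n. (-1) ^ k * ((s + of_nat k) gchoose k)
              / ((of_nat (k + 1))\<^sup>2 * of_nat (n choose (k + 1)))
              * ((Digamma (s + of_nat k + 1) - Digamma (s + 1))\<^sup>2
                  + deriv Digamma (s + of_nat k + 1) - deriv Digamma (s + 1)))"
proof -
  \<comment> \<open>The complement of the excluded points -1, -2, ...; it contains 0.\<close>
  define S where "S = {s::complex. s + 1 \<notin> \<int>\<^sub>\<le>\<^sub>0}"
  have "open S"
    using open_shifted_nonpos_Ints_compl[of 0] by (simp add: S_def)
  have "s \<in> S"
  proof -
    have "s + 1 \<noteq> - of_nat m" for m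
    proof
      assume "s + 1 = - of_nat m"
      then have "s = - of_nat (Suc m)" by (simp add: algebra_simps eq_neg_iff_add_eq_0)
      with assms(2) show False by fastforce
    qed
    then show ?thesis by (auto simp: S_def elim!: nonpos_Ints_cases')
  qed
  define a where "a k = (-1) ^ (k - 1) / (of_nat k :: complex)" for k
  define b where "b k = (-1) ^ k / ((of_nat (k + 1))\<^sup>2 * (of_nat (n choose (k + 1)) :: complex))" for k
  \<comment> \<open>One family serves both sides: j = n on the left, j = k on the right. For j = k
    the second digamma argument becomes x + 1.\<close>
  define B where "B j k x = (x + of_nat j) gchoose k" for j k and x :: complex
  define B1 where "B1 j k x = B j k x * (Digamma (x + of_nat j + 1) - Digamma (x + of_nat j - of_nat k + 1))"
    for j k x
  define B2 where "B2 j k x = B j k x * ((Digamma (x + of_nat j + 1) - Digamma (x + of_nat j - of_nat k + 1))\<^sup>2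
      + deriv Digamma (x + of_nat j + 1) - deriv Digamma (x + of_nat j - of_nat k + 1))" for j k x
  \<comment> \<open>The argument is x + 1 moved right by the natural number j - k, so it avoids the
    poles.\<close>
  have mem: "x + of_nat j - of_nat k + 1 \<notin> \<int>\<^sub>\<le>\<^sub>0" if "x \<in> S" "k \<le> j" for x j k
    using plus_of_nat_not_in_nonpos_Ints[of "x + 1" "j - k"] that
    by (simp add: S_def of_nat_diff algebra_simps)
  have D1: "(B j k has_field_derivative B1 j k x) (at x)" if "x \<in> S" "k \<le> j" for x j k
    using has_field_derivative_gbinomial[OF mem[OF that]]
    unfolding B_def[abs_def] B1_def by (subst (asm) DERIV_shift)
  have D2: "(B1 j k has_field_derivative B2 j k x) (at x)" if "x \<in> S" "k \<le> j" for x j k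
    using has_field_derivative_gbinomial_Digamma[OF mem[OF that]]
    unfolding B_def[abs_def] B1_def[abs_def] B2_def by (subst (asm) DERIV_shift)
  define F where "F = (\<lambda>x. \<Sum>k=1..n. a k * B n k x)"
  define F1 where "F1 = (\<lambda>x. \<Sum>k=1..n. a k * B1 n k x)"
  define F2 where "F2 = (\<lambda>x. \<Sum>k=1..n. a k * B2 n k x)"
  define G where "G = (\<lambda>x. \<Sum>k=0..<n. b k * B k k x)"
  define G1 where "G1 = (\<lambda>x. \<Sum>k=0..<n. b k * B1 k k x)"
  define G2 where "G2 = (\<lambda>x. \<Sum>k=0..<n. b k * B2 k k x)"
  have F: "(F has_field_derivative F1 x) (at x)" if "x \<in> S" for x
    unfolding F_def F1_def by (intro DERIV_sum DERIV_cmult D1 that) auto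
  have F1: "(F1 has_field_derivative F2 x) (at x)" if "x \<in> S" for x
    unfolding F2_def F1_def by (intro DERIV_sum DERIV_cmult D2 that) auto
  have G: "(G has_field_derivative G1 x) (at x)" if "x \<in> S" for x
    unfolding G_def G1_def by (intro DERIV_sum DERIV_cmult D1 that) auto
  have G1: "(G1 has_field_derivative G2 x) (at x)" if "x \<in> S" for x
    unfolding G2_def G1_def by (intro DERIV_sum DERIV_cmult D2 that) auto
  have F_eq: "F = (\<lambda>x. F 0 + x * G x)"
    using gbinomial_harmonic_sum_eq[OF assms(1)]
    by (simp add: F_def G_def B_def a_def b_def fun_eq_iff)
  have F1_eq: "F1 x = G x + x * G1 x" if "x \<in> S" for x
  proof (rule DERIV_unique[OF F[OF that]])
    show "(F has_field_derivative G x + x * G1 x) (at x)"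
      by (subst F_eq) (auto intro!: derivative_eq_intros G that)
  qed
  have "F2 s = 2 * G1 s + s * G2 s"
  proof (rule DERIV_unique[OF F1[OF \<open>s \<in> S\<close>]])
    have "((\<lambda>x. G x + x * G1 x) has_field_derivative 2 * G1 s + s * G2 s) (at s)"
      by (auto intro!: derivative_eq_intros G G1 \<open>s \<in> S\<close>)
    \<comment> \<open>\<open>F1_eq\<close> is available on \<open>S\<close> only; since
      \<open>S\<close> is open, agreement there suffices for the derivative at
      \<open>s\<close>.\<close>
    then show "(F1 has_field_derivative 2 * G1 s + s * G2 s) (at s)"
      by (rule has_field_derivative_transform_within_open[OF _ \<open>open S\<close> \<open>s \<in> S\<close>])
        (simp add: F1_eq)
  qed
  then show ?thesis
    by (simp add: F2_def G1_def G2_def B_def B1_def B2_def a_def b_def mult.assoc)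
qed

end
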